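(* Let $A=\{a_1<a_2<\cdots\}\subset\mathbb N$ be an infinite set. Then the following conditions are equivalent: i) for every $c>1$: $A(ct)>A(t)$ for all sufficiently large $t$; ii) for every $c>1$: $\lim_{t\to\infty}(A(ct)-A(t))=\infty$; iii) for every $k\ge2$ and every infinite $B\subset\mathbb N$: $R^k(A;B)$ is dense in $\mathbb R_+^{k-1}$; iv) for every $k\ge2$ and every infinite $B\subset\mathbb N$: $D^k(A;B)$ is dense in $\mathbb S_+^{k-1}$; v) there exists $k\ge2$ such that for every infinite $B\subset\mathbb N$: $R^k(A;B)$ is dense in $\mathbb R_+^{k-1}$; vi) there exists $k\ge2$ such that for every infinite $B\subset\mathbb N$: $D^k(A;B)$ is dense in $\mathbb S_+^{k-1}$; vii) for every infinite $B\subset\mathbb N$ there exists $k\ge2$ such that $R^k(A;B)$ is dense in $\mathbb R_+^{k-1}$; viii) for every infinite $B\subset\mathbb N$ there exists $k\ge2$ such that $D^k(A;B)$ is dense in $\mathbb S_+^{k-1}$; ix) $A$ is $(N)$-dense; x) $\lim_{n\to\infty}\frac{a_{n+1}}{a_n}=1$; xi) $\lim_{n\to\infty}\frac1{a_n}\max\{a_1,\,a_{i+1}-a_i: i\in\{1,\dots,n-1\}\}=0$.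
   Context: $\mathbb N$ is the set of positive integers; $A(x)=\#\{a\in A:a\le x\}$ is the counting function of $A\subset\mathbb N$; $t$ ranges over positive reals and $k$ over integers. $\mathbb R_+=(0,\infty)$, and $\mathbb S_+^{k-1}=\{(x_1,\dots,x_k)\in\mathbb R_+^k:\sum_{i=1}^k x_i^2=1\}$. For $k\ge2$ and $A,B\subset\mathbb N$: $$R^k(A;B)=\left\{\left(\tfrac{a_1}{b},\dots,\tfrac{a_{k-1}}{b}\right): a_1,\dots,a_{k-1}\in A,\ b\in B\right\}$$ (the generalized ratio set; here $a_1,\dots,a_{k-1}$ are arbitrary elements of $A$), and $$D^k(A;B)=\left\{\left(\tfrac{a_1}{\sqrt{\sum_{i=1}^k a_i^2}},\dots,\tfrac{a_k}{\sqrt{\sum_{i=1}^k a_i^2}}\right): a_1,\dots,a_{k-1}\in A,\ a_k\in B\right\}$$ (the $k$-th directions set). For $A,B\subset\mathbb N$ put $R(A,B)=\{\frac ab: a\in A,\ b\in B\}$. The set $A$ is called $(N)$-dense if $R(A,B)$ is dense in $(0,\infty)$ for every infinite $B\subset\mathbb N$. *)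

theory Defs
  imports "HOL-Analysis.Analysis"
begin

text \<open>
  The positive integers are \<open>{1..} :: nat set\<close>. A point of \<open>n\<close>-dimensional real space is an
  element of \<open>powertop_real {1..n}\<close>, i.e. an extensional function on \<open>{1..n}\<close>; the product
  topology on it is the Euclidean one. In this way the dimension remains a term.
\<close>

definition counting :: "nat set \<Rightarrow> real \<Rightarrow> nat" where
  "counting A x = card {a \<in> A. real a \<le> x}"

definition pos_orthant :: "nat \<Rightarrow> (nat \<Rightarrow> real) set" where
  "pos_orthant n = (\<Pi>\<^sub>E i\<in>{1..n}. {0<..})"

text \<open>Indexed by the dimension \<open>k\<close> of the ambient space, not by that of the sphere.\<close>

definition pos_sphere :: "nat \<Rightarrow> (nat \<Rightarrow> real) set" where
  "pos_sphere k = {x \<in> pos_orthant k. (\<Sum>i=1..k. (x i)\<^sup>2) = 1}"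

text \<open>\<open>dense_in X T S\<close>: \<open>S\<close> is dense in the subspace \<open>T\<close> of \<open>X\<close>.\<close>

definition dense_in :: "'a topology \<Rightarrow> 'a set \<Rightarrow> 'a set \<Rightarrow> bool" where
  "dense_in X T S \<longleftrightarrow> (subtopology X T) closure_of S = T"

definition gen_ratio_set :: "nat \<Rightarrow> nat set \<Rightarrow> nat set \<Rightarrow> (nat \<Rightarrow> real) set" where
  "gen_ratio_set k A B =
     {(\<lambda>i\<in>{1..k-1}. real (a i) / real b) | a b. (\<forall>i\<in>{1..k-1}. a i \<in> A) \<and> b \<in> B}"

definition directions_set :: "nat \<Rightarrow> nat set \<Rightarrow> nat set \<Rightarrow> (nat \<Rightarrow> real) set" where
  "directions_set k A B =
     {(\<lambda>i\<in>{1..k}. real (a i) / sqrt (\<Sum>j=1..k. (real (a j))\<^sup>2)) | a.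
        (\<forall>i\<in>{1..k-1}. a i \<in> A) \<and> a k \<in> B}"

definition gen_ratio_dense :: "nat \<Rightarrow> nat set \<Rightarrow> nat set \<Rightarrow> bool" where
  "gen_ratio_dense k A B \<longleftrightarrow>
     dense_in (powertop_real {1..k-1}) (pos_orthant (k-1)) (gen_ratio_set k A B)"

definition directions_dense :: "nat \<Rightarrow> nat set \<Rightarrow> nat set \<Rightarrow> bool" where
  "directions_dense k A B \<longleftrightarrow>
     dense_in (powertop_real {1..k}) (pos_sphere k) (directions_set k A B)"

definition ratio_set :: "nat set \<Rightarrow> nat set \<Rightarrow> real set" where
  "ratio_set A B = {real a / real b | a b. a \<in> A \<and> b \<in> B}"

definition N_dense :: "nat set \<Rightarrow> bool" where
  "N_dense A \<longleftrightarrow>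
     (\<forall>B. B \<subseteq> {1..} \<and> infinite B \<longrightarrow> dense_in euclideanreal {0<..} (ratio_set A B))"

definition all_equivalent :: "bool list \<Rightarrow> bool" where
  "all_equivalent Ps \<longleftrightarrow> (\<forall>P\<in>set Ps. \<forall>Q\<in>set Ps. P \<longleftrightarrow> Q)"

end

theory Submission
  imports Defs
begin

text \<open>
  Everything is compared with one condition on \<open>A\<close>, called \<open>relative_gaps_vanish\<close>: for every
  \<open>c > 1\<close>, all intervals \<open>(t, c t]\<close> with \<open>t\<close> large meet \<open>A\<close>. It is (i) with the counting function
  removed, and (ii) follows by splitting \<open>(t, c t]\<close> into many intervals of the same kind.

  The density statements form a chain from strong to weak. At the strong end, if relative gaps
  vanish, then for a fixed \<open>x > 0\<close> and \<^emph>\<open>every\<close> sufficiently large \<open>b\<close> some \<open>a/b\<close> with \<open>a\<close> in \<open>A\<close> is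
  close to \<open>x\<close>. As this holds for all large \<open>b\<close> and not only for some, finitely many coordinates can
  be approximated with one common denominator, which can be taken in any given infinite set \<open>B\<close>. At
  the weak end, projection to the first coordinate turns density of \<open>R\<^sup>k(A;B)\<close>, for any one
  \<open>k \<ge> 2\<close>, into density of \<open>R(A,B)\<close>, so even the weakest of the conditions on \<open>R\<^sup>k\<close> gives
  \<open>(N)\<close>-density. The chain closes because large relative gaps are incompatible with
  \<open>(N)\<close>-density: if infinitely many integers \<open>b\<close> have no element of \<open>A\<close> in \<open>(b, c b]\<close>, then these
  \<open>b\<close> form a set \<open>B\<close> for which \<open>R(A,B)\<close> misses \<open>(1, c)\<close>.

  Directions add nothing new: central projection of the affine hyperplane \<open>x\<^sub>k = 1\<close> is a
  homeomorphism from the open orthant of dimension \<open>k - 1\<close> onto the positive part of the sphere, and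
  it carries \<open>R\<^sup>k(A;B)\<close> to \<open>D\<^sup>k(A;B)\<close>, for each \<open>k\<close> and \<open>B\<close> separately.

  Finally (x) and (xi) are the same condition for an enumeration of \<open>A\<close>. In (xi) the gaps before any
  fixed index are negligible against \<open>a\<^sub>n\<close>, and the later ones are small multiples of smaller
  elements.
\<close>

section \<open>Vanishing relative gaps and the counting function\<close>

definition relative_gaps_vanish :: "nat set \<Rightarrow> bool" where
  "relative_gaps_vanish A \<longleftrightarrow>
     (\<forall>c>1. \<forall>\<^sub>F t in at_top. \<exists>n\<in>A. t < real n \<and> real n \<le> c * t)"

lemma finite_real_atMost: "finite {n \<in> A. real n \<le> x}"
proof (rule finite_subset)
  show "{n \<in> A. real n \<le> x} \<subseteq> {..nat \<lfloor>x\<rfloor>}"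
    by (auto simp: le_nat_floor)
qed simp

lemma counting_mono: "x \<le> y \<Longrightarrow> counting A x \<le> counting A y"
  unfolding counting_def by (intro card_mono finite_real_atMost) auto

lemma counting_less_iff:
  assumes "x \<le> y"
  shows "counting A x < counting A y \<longleftrightarrow> (\<exists>n\<in>A. x < real n \<and> real n \<le> y)"
proof
  assume less: "counting A x < counting A y"
  show "\<exists>n\<in>A. x < real n \<and> real n \<le> y"
  proof (rule ccontr)
    assume "\<not> ?thesis"
    then have "{n \<in> A. real n \<le> y} \<subseteq> {n \<in> A. real n \<le> x}"
      by force
    then have "counting A y \<le> counting A x"
      unfolding counting_def by (intro card_mono finite_real_atMost)
    with less show False by simp
  qed
next
  assume "\<exists>n\<in>A. x < real n \<and> real n \<le> y"
  then have "{n \<in> A. real n \<le> x} \<subset> {n \<in> A. real n \<le> y}"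
    using assms by force
  then show "counting A x < counting A y"
    unfolding counting_def by (intro psubset_card_mono finite_real_atMost)
qed

lemma relative_gaps_vanish_iff_counting_less:
  "relative_gaps_vanish A \<longleftrightarrow>
     (\<forall>c::real. c > 1 \<longrightarrow> (\<forall>\<^sub>F t in at_top. counting A (c * t) > counting A t))"
proof -
  have "(\<forall>\<^sub>F t in at_top. counting A (c * t) > counting A t) \<longleftrightarrow>
        (\<forall>\<^sub>F t in at_top. \<exists>n\<in>A. t < real n \<and> real n \<le> c * t)" if "c > 1" for c :: real
  proof (rule eventually_cong[OF eventually_ge_at_top[of 0]])
    fix t :: real assume "0 \<le> t"
    then have "t \<le> c * t"
      using that mult_right_mono[of 1 c t] by simp
    then show "counting A (c * t) > counting A t \<longleftrightarrow> (\<exists>n\<in>A. t < real n \<and> real n \<le> c * t)"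
      by (rule counting_less_iff)
  qed
  then show ?thesis
    unfolding relative_gaps_vanish_def by auto
qed

text \<open>
  Induction on \<open>m\<close>: with \<open>s = sqrt c\<close>, the interval \<open>(t, s t]\<close> holds \<open>m\<close> elements and \<open>(s t, c t]\<close>
  one more.
\<close>

lemma relative_gaps_vanish_imp_counting_ge:
  assumes "relative_gaps_vanish A" and "c > 1"
  shows "\<forall>\<^sub>F t in at_top. counting A t + m \<le> counting A (c * t)"
  using \<open>c > 1\<close>
proof (induction m arbitrary: c)
  case 0
  show ?case
    using eventually_ge_at_top[of 0]
  proof eventually_elim
    case (elim t)
    then have "t \<le> c * t"
      using 0 mult_right_mono[of 1 c t] by simp
    then show ?case by (simp add: counting_mono)
  qed
next
  case (Suc m)
  define s where "s = sqrt c"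
  have s: "s > 1" "s * s = c"
    using Suc.prems by (auto simp: s_def)
  from Suc.IH[OF s(1)] obtain T1 where T1: "\<And>t. t \<ge> T1 \<Longrightarrow> counting A t + m \<le> counting A (s * t)"
    unfolding eventually_at_top_linorder by blast
  from assms(1) s(1) obtain T2 where T2: "\<And>t. t \<ge> T2 \<Longrightarrow> counting A t < counting A (s * t)"
    unfolding relative_gaps_vanish_iff_counting_less eventually_at_top_linorder by blast
  show ?case
    using eventually_ge_at_top[of "max 0 (max T1 T2)"]
  proof eventually_elim
    case (elim t)
    then have "t \<le> s * t"
      using s(1) mult_right_mono[of 1 s t] by simp
    then have "counting A (s * t) < counting A (s * (s * t))"
      using T2 elim by simp
    moreover have "s * (s * t) = c * t"
      using s(2) by (simp add: mult.assoc[symmetric])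
    ultimately show ?case using T1[of t] elim by simp
  qed
qed

lemma relative_gaps_vanish_iff_counting_diff_at_top:
  "relative_gaps_vanish A \<longleftrightarrow>
     (\<forall>c::real. c > 1 \<longrightarrow>
       filterlim (\<lambda>t. real (counting A (c * t)) - real (counting A t)) at_top at_top)"
    (is "_ \<longleftrightarrow> ?R")
proof
  assume A: "relative_gaps_vanish A"
  show ?R
    unfolding filterlim_at_top
  proof (intro allI impI)
    fix c Z :: real assume "c > 1"
    show "\<forall>\<^sub>F t in at_top. Z \<le> real (counting A (c * t)) - real (counting A t)"
      using relative_gaps_vanish_imp_counting_ge[OF A \<open>c > 1\<close>, of "nat \<lceil>Z\<rceil>"]
    proof eventually_elim
      case (elim t)
      then have "real (counting A t) + real (nat \<lceil>Z\<rceil>) \<le> real (counting A (c * t))"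
        by (metis of_nat_add of_nat_mono)
      then show ?case
        using real_nat_ceiling_ge[of Z] by linarith
    qed
  qed
next
  assume R: ?R
  show "relative_gaps_vanish A"
    unfolding relative_gaps_vanish_iff_counting_less
  proof (intro allI impI)
    fix c :: real assume "c > 1"
    with R have "\<forall>\<^sub>F t in at_top. 0 < real (counting A (c * t)) - real (counting A t)"
      unfolding filterlim_at_top_dense by blast
    then show "\<forall>\<^sub>F t in at_top. counting A (c * t) > counting A t"
      by eventually_elim simp
  qed
qed

section \<open>Density of the ratio sets\<close>

lemma dense_in_continuous_image:
  assumes f: "continuous_map (subtopology X S) (subtopology Y T) f" and surj: "f ` S = T"
    and D: "dense_in X S D"
  shows "dense_in Y T (f ` D)"
  unfolding dense_in_def
proof
  show "(subtopology Y T) closure_of (f ` D) \<subseteq> T"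
    by (rule closure_of_subset_subtopology)
  have "T = f ` ((subtopology X S) closure_of D)"
    using D surj by (simp add: dense_in_def)
  also have "\<dots> \<subseteq> (subtopology Y T) closure_of (f ` D)"
    by (rule continuous_map_image_closure_subset[OF f])
  finally show "T \<subseteq> (subtopology Y T) closure_of (f ` D)" .
qed

lemma topspace_pos_orthant:
  "topspace (subtopology (powertop_real {1..n}) (pos_orthant n)) = pos_orthant n"
  by (auto simp: pos_orthant_def topspace_subtopology PiE_def)

text \<open>
  The condition \<open>x < n/b \<le> x + e\<close> says that \<open>n\<close> lies in \<open>(t, c t]\<close> with \<open>t = x b\<close> and
  \<open>c = 1 + e/x\<close>, where \<open>c\<close> is independent of \<open>b\<close>.
\<close>

lemma ratio_eventually_in_open:
  fixes x :: real
  assumes A: "relative_gaps_vanish A" and X: "open X" "x \<in> X" and "x > 0"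
  shows "\<forall>\<^sub>F b in sequentially. \<exists>n\<in>A. real n / real b \<in> X"
proof -
  obtain e where e: "e > 0" "cball x e \<subseteq> X"
    using X by (auto simp: open_contains_cball)
  have "1 + e / x > 1"
    using e(1) \<open>x > 0\<close> by simp
  then have "\<forall>\<^sub>F t in at_top. \<exists>n\<in>A. t < real n \<and> real n \<le> (1 + e / x) * t"
    using A unfolding relative_gaps_vanish_def by blast
  moreover have "filterlim (\<lambda>b. x * real b) at_top sequentially"
    by (intro filterlim_tendsto_pos_mult_at_top[OF tendsto_const \<open>x > 0\<close>]
        filterlim_real_sequentially)
  ultimately have "\<forall>\<^sub>F b in sequentially.
      \<exists>n\<in>A. x * real b < real n \<and> real n \<le> (1 + e / x) * (x * real b)"
    by (rule eventually_compose_filterlim)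
  then show ?thesis
    using eventually_gt_at_top[of 0]
  proof eventually_elim
    case (elim b)
    then obtain n where n: "n \<in> A" "x * real b < real n" "real n \<le> (1 + e / x) * (x * real b)"
      by blast
    have "(1 + e / x) * (x * real b) = (x + e) * real b"
      using \<open>x > 0\<close> by (simp add: field_simps)
    then have "x < real n / real b" "real n / real b \<le> x + e"
      using n elim by (simp_all add: field_simps)
    then have "real n / real b \<in> cball x e"
      by (simp add: dist_real_def)
    then show ?case using n(1) e(2) by blast
  qed
qed

text \<open>
  A basic neighbourhood in the orthant is a box. Each of its finitely many sides is hit by \<open>a/b\<close> for
  all large \<open>b\<close>, so one large \<open>b\<close> in \<open>B\<close> serves all coordinates at once.
\<close>

lemma relative_gaps_vanish_imp_gen_ratio_dense:
  assumes A: "relative_gaps_vanish A" and B: "infinite B"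
  shows "gen_ratio_dense k A B"
proof -
  let ?I = "{1..k-1}"
  let ?P = "subtopology (powertop_real ?I) (pos_orthant (k-1))"
  have P: "?P = product_topology (\<lambda>i. top_of_set {0<..}) ?I"
    by (simp add: pos_orthant_def subtopology_product_topology)
  have "x \<in> ?P closure_of (gen_ratio_set k A B)" if x: "x \<in> pos_orthant (k-1)" for x
    unfolding in_closure_of
  proof (intro conjI allI impI)
    show "x \<in> topspace ?P"
      using x by (simp only: topspace_pos_orthant)
    fix U assume "x \<in> U \<and> openin ?P U"
    then obtain X where X: "x \<in> (\<Pi>\<^sub>E i\<in>?I. X i)" "\<And>i. openin (top_of_set {0<..}) (X i)"
        "(\<Pi>\<^sub>E i\<in>?I. X i) \<subseteq> U"
      unfolding P using product_topology_open_contains_basis[of "\<lambda>_. top_of_set {0<..}" ?I U x] by blast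
    have hit: "\<forall>\<^sub>F b in sequentially. \<exists>n\<in>A. real n / real b \<in> X i" if i: "i \<in> ?I" for i
    proof -
      have "open (X i)"
        by (rule openin_open_trans[OF X(2)]) simp
      moreover have "x i \<in> X i" "x i > 0"
        using X(1) x i by (auto simp: pos_orthant_def)
      ultimately show ?thesis
        using ratio_eventually_in_open[OF A] by blast
    qed
    then have hit_all: "\<forall>\<^sub>F b in sequentially. \<forall>i\<in>?I. \<exists>n\<in>A. real n / real b \<in> X i"
      by (intro eventually_ball_finite) auto
    have "\<exists>\<^sub>F b in sequentially. b \<in> B"
      using B by (simp add: cofinite_eq_sequentially[symmetric] frequently_cofinite)
    from frequently_ex[OF frequently_eventually_conj[OF this hit_all]]
    obtain b where b: "b \<in> B" "\<forall>i\<in>?I. \<exists>n\<in>A. real n / real b \<in> X i"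
      by blast
    then obtain a where a: "\<forall>i\<in>?I. a i \<in> A \<and> real (a i) / real b \<in> X i"
      using bchoice[of ?I "\<lambda>i n. n \<in> A \<and> real n / real b \<in> X i"] by blast
    let ?y = "\<lambda>i\<in>?I. real (a i) / real b"
    have "?y \<in> gen_ratio_set k A B"
      unfolding gen_ratio_set_def using a b by blast
    moreover have "?y \<in> U"
      by (rule subsetD[OF X(3)]) (use a in simp)
    ultimately show "\<exists>y. y \<in> gen_ratio_set k A B \<and> y \<in> U"
      by blast
  qed
  then show ?thesis
    unfolding gen_ratio_dense_def dense_in_def
    by (intro subset_antisym closure_of_subset_subtopology subsetI)
qed

lemma gen_ratio_dense_imp_ratio_set_dense:
  assumes "k \<ge> 2" and dense: "gen_ratio_dense k A B"
  shows "dense_in euclideanreal {0<..} (ratio_set A B)"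
proof -
  have one: "1 \<in> {1..k-1}"
    using \<open>k \<ge> 2\<close> by simp
  have surj: "(\<lambda>x. x 1) ` pos_orthant (k-1) = {0<..}"
  proof safe
    fix y :: real assume "0 < y"
    then have "(\<lambda>i\<in>{1..k-1}. y) \<in> pos_orthant (k-1)"
      by (auto simp: pos_orthant_def)
    moreover have "y = (\<lambda>i\<in>{1..k-1}. y) 1"
      using one by simp
    ultimately show "y \<in> (\<lambda>x. x 1) ` pos_orthant (k-1)"
      by blast
  qed (use one in \<open>auto simp: pos_orthant_def\<close>)
  have "continuous_map (subtopology (powertop_real {1..k-1}) (pos_orthant (k-1)))
          (top_of_set {0<..}) (\<lambda>x. x 1)"
    unfolding continuous_map_in_subtopology topspace_pos_orthant
    using surj one by (auto intro!: continuous_map_from_subtopology continuous_map_product_coordinates)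
  from dense_in_continuous_image[OF this surj dense[unfolded gen_ratio_dense_def]]
  have "dense_in euclideanreal {0<..} ((\<lambda>x. x 1) ` gen_ratio_set k A B)" .
  moreover have "(\<lambda>x. x 1) ` gen_ratio_set k A B = ratio_set A B"
  proof safe
    fix x assume "x \<in> gen_ratio_set k A B"
    then show "x 1 \<in> ratio_set A B"
      using one unfolding gen_ratio_set_def ratio_set_def by fastforce
  next
    fix y assume "y \<in> ratio_set A B"
    then obtain n b where n: "n \<in> A" "b \<in> B" "y = real n / real b"
      by (auto simp: ratio_set_def)
    then have "(\<lambda>i\<in>{1..k-1}. real n / real b) \<in> gen_ratio_set k A B"
      unfolding gen_ratio_set_def
      by (auto intro!: exI[of _ "\<lambda>_. n"] exI[of _ b])
    moreover have "y = (\<lambda>i\<in>{1..k-1}. real n / real b) 1"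
      using one n by simp
    ultimately show "y \<in> (\<lambda>x. x 1) ` gen_ratio_set k A B"
      by blast
  qed
  ultimately show ?thesis by simp
qed

text \<open>
  If arbitrarily large \<open>t\<close> have no element of \<open>A\<close> in \<open>(t, c t]\<close>, then rounding \<open>t\<close> up gives infinitely
  many integers \<open>b\<close> with no element in \<open>(b, c' b]\<close>, for a slightly smaller \<open>c' > 1\<close>. For these \<open>b\<close> no
  quotient \<open>a/b\<close> lies in \<open>(1, c')\<close>.
\<close>

lemma N_dense_imp_relative_gaps_vanish:
  assumes "N_dense A"
  shows "relative_gaps_vanish A"
  unfolding relative_gaps_vanish_def
proof (intro allI impI, rule ccontr)
  fix c :: real assume c: "c > 1"
  assume "\<not> (\<forall>\<^sub>F t in at_top. \<exists>n\<in>A. t < real n \<and> real n \<le> c * t)"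
  then have gap: "\<exists>t\<ge>T. \<not> (\<exists>n\<in>A. t < real n \<and> real n \<le> c * t)" for T
    by (auto simp: eventually_at_top_linorder)
  define c' where "c' = (1 + c) / 2"
  have c': "1 < c'" "c' < c"
    using c by (auto simp: c'_def)
  define B where "B = {b::nat. b \<ge> 1 \<and> \<not> (\<exists>n\<in>A. real b < real n \<and> real n \<le> c' * real b)}"
  have "\<exists>b\<ge>N. b \<in> B" for N
  proof -
    \<comment> \<open>The third bound makes \<open>c' (t + 1) \<le> c t\<close>, which absorbs the rounding.\<close>
    obtain t where t: "t \<ge> max 1 (max (real N) (c' / (c - c')))"
        "\<not> (\<exists>n\<in>A. t < real n \<and> real n \<le> c * t)"
      using gap by blast
    define b where "b = nat \<lceil>t\<rceil>"
    have b: "t \<le> real b" "real b < t + 1"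
      using t(1) by (auto simp: b_def) linarith+
    have "c' / (c - c') \<le> t"
      using t(1) by simp
    then have "c' * (t + 1) \<le> c * t"
      using c' by (simp add: field_simps)
    moreover have "c' * real b \<le> c' * (t + 1)"
      using b c' by (intro mult_left_mono) auto
    ultimately have "c' * real b \<le> c * t" by linarith
    then have "\<not> (\<exists>n\<in>A. real b < real n \<and> real n \<le> c' * real b)"
      using t(2) b(1) by force
    moreover have "b \<ge> 1" "b \<ge> N"
      using b(1) t(1) by auto
    ultimately show ?thesis by (auto simp: B_def)
  qed
  then have "infinite B"
    by (simp add: infinite_nat_iff_unbounded_le)
  moreover have "B \<subseteq> {1..}"
    by (auto simp: B_def)
  ultimately have "dense_in euclideanreal {0<..} (ratio_set A B)"
    using assms by (simp add: N_dense_def)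
  moreover have "openin (top_of_set {0<..}) {1<..<c'}"
    by (intro open_subset) auto
  moreover have "(1 + c') / 2 \<in> {0<..}" "(1 + c') / 2 \<in> {1<..<c'}"
    using c' by (auto simp: field_simps)
  ultimately obtain y where "y \<in> ratio_set A B" "y \<in> {1<..<c'}"
    unfolding dense_in_def by (metis in_closure_of)
  then obtain n b where n: "n \<in> A" "b \<in> B" "1 < real n / real b" "real n / real b < c'"
    by (auto simp: ratio_set_def)
  moreover have "real b > 0"
    using n(2) by (auto simp: B_def)
  ultimately have "real b < real n" "real n \<le> c' * real b"
    by (simp_all add: field_simps)
  with n(1,2) show False by (auto simp: B_def)
qed

section \<open>Central projection onto the sphere\<close>

text \<open>
  The two inverse homeomorphisms between the orthant of dimension \<open>k - 1\<close>, placed at height \<open>1\<close> in the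
  \<open>k\<close>-th coordinate, and the positive part of the sphere.
\<close>

definition to_sphere :: "nat \<Rightarrow> (nat \<Rightarrow> real) \<Rightarrow> nat \<Rightarrow> real" where
  "to_sphere k x =
     (\<lambda>i\<in>{1..k}. (if i = k then 1 else x i) / sqrt (\<Sum>j=1..k. (if j = k then 1 else x j)\<^sup>2))"

definition from_sphere :: "nat \<Rightarrow> (nat \<Rightarrow> real) \<Rightarrow> nat \<Rightarrow> real" where
  "from_sphere k y = (\<lambda>i\<in>{1..k-1}. y i / y k)"

lemma lifted_norm_pos:
  fixes x :: "nat \<Rightarrow> real"
  assumes "k \<ge> 1"
  shows "(\<Sum>j=1..k. (if j = k then 1 else x j)\<^sup>2) > 0"
  using assms by (intro sum_pos2[of "{1..k}" k]) auto

lemma normalized_eq_of_proportional: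
  fixes u v :: "nat \<Rightarrow> real"
  assumes "s > 0" and "\<And>j. j \<in> {1..k} \<Longrightarrow> u j = s * v j" and "i \<in> {1..k}"
  shows "u i / sqrt (\<Sum>j=1..k. (u j)\<^sup>2) = v i / sqrt (\<Sum>j=1..k. (v j)\<^sup>2)"
proof -
  have "(\<Sum>j=1..k. (u j)\<^sup>2) = s\<^sup>2 * (\<Sum>j=1..k. (v j)\<^sup>2)"
    using assms(2) by (simp add: sum_distrib_left power_mult_distrib)
  then show ?thesis
    using assms by (simp add: real_sqrt_mult)
qed

lemma to_sphere_in_pos_sphere:
  assumes "k \<ge> 1" and x: "x \<in> pos_orthant (k-1)"
  shows "to_sphere k x \<in> pos_sphere k"
proof -
  let ?v = "\<lambda>j. if j = k then 1 else x j"
  have pos: "(\<Sum>j=1..k. (?v j)\<^sup>2) > 0"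
    by (rule lifted_norm_pos[OF assms(1)])
  have "?v i > 0" if "i \<in> {1..k}" for i
    using that x by (auto simp: pos_orthant_def)
  then have "to_sphere k x \<in> pos_orthant k"
    using pos by (auto simp: to_sphere_def pos_orthant_def)
  moreover have "(\<Sum>i=1..k. (to_sphere k x i)\<^sup>2) = (\<Sum>i=1..k. (?v i)\<^sup>2 / (\<Sum>j=1..k. (?v j)\<^sup>2))"
    using pos by (intro sum.cong) (auto simp: to_sphere_def power_divide)
  moreover have "\<dots> = 1"
    using pos by (simp add: sum_divide_distrib[symmetric])
  ultimately show ?thesis
    by (simp add: pos_sphere_def)
qed

lemma from_sphere_in_pos_orthant:
  assumes "k \<ge> 1" and y: "y \<in> pos_sphere k"
  shows "from_sphere k y \<in> pos_orthant (k-1)"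
proof -
  have pos: "0 < y j" if "j \<in> {1..k}" for j
    using y that by (auto simp: pos_sphere_def pos_orthant_def)
  have "0 < y i / y k" if "i \<in> {1..k-1}" for i
    using that pos[of i] pos[of k] \<open>k \<ge> 1\<close> by auto
  then show ?thesis
    unfolding from_sphere_def pos_orthant_def by auto
qed

lemma from_sphere_to_sphere:
  assumes "k \<ge> 1" and x: "x \<in> pos_orthant (k-1)"
  shows "from_sphere k (to_sphere k x) = x"
proof
  fix i
  show "from_sphere k (to_sphere k x) i = x i"
  proof (cases "i \<in> {1..k-1}")
    case True
    then have "i \<noteq> k" "i \<in> {1..k}" using assms(1) by auto
    then show ?thesis
      using lifted_norm_pos[OF assms(1), of x] True assms(1)
      by (auto simp: from_sphere_def to_sphere_def)
  next
    case False
    then show ?thesis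
      using x by (auto simp: from_sphere_def pos_orthant_def PiE_def extensional_def)
  qed
qed

lemma to_sphere_from_sphere:
  assumes "k \<ge> 1" and y: "y \<in> pos_sphere k"
  shows "to_sphere k (from_sphere k y) = y"
proof
  fix i
  have yk: "y k > 0" and norm: "(\<Sum>j=1..k. (y j)\<^sup>2) = 1"
    using assms by (auto simp: pos_sphere_def pos_orthant_def)
  show "to_sphere k (from_sphere k y) i = y i"
  proof (cases "i \<in> {1..k}")
    case True
    let ?v = "\<lambda>j. if j = k then 1 else from_sphere k y j"
    have "y j = y k * ?v j" if "j \<in> {1..k}" for j
      using that yk by (auto simp: from_sphere_def)
    from normalized_eq_of_proportional[of "y k" k y ?v i, OF yk this True] True norm
    show ?thesis
      by (simp add: to_sphere_def)
  next
    case False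
    then show ?thesis
      using y by (auto simp: to_sphere_def pos_sphere_def pos_orthant_def PiE_def extensional_def)
  qed
qed

lemma topspace_pos_sphere:
  "topspace (subtopology (powertop_real {1..k}) (pos_sphere k)) = pos_sphere k"
  by (auto simp: pos_sphere_def pos_orthant_def topspace_subtopology PiE_def)

lemma continuous_map_to_sphere:
  assumes "k \<ge> 1"
  shows "continuous_map (subtopology (powertop_real {1..k-1}) (pos_orthant (k-1)))
           (subtopology (powertop_real {1..k}) (pos_sphere k)) (to_sphere k)"
proof -
  let ?X = "subtopology (powertop_real {1..k-1}) (pos_orthant (k-1))"
  have coord: "continuous_map ?X euclideanreal (\<lambda>x. if j = k then 1 else x j)"
    if "j \<in> {1..k}" for j
    using that
    by (cases "j = k")
      (auto intro!: continuous_map_from_subtopology continuous_map_product_coordinates)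
  have "sqrt (\<Sum>j=1..k. (if j = k then 1 else x j)\<^sup>2) \<noteq> 0" for x :: "nat \<Rightarrow> real"
    using lifted_norm_pos[OF assms, of x] by simp
  then have "continuous_map ?X euclideanreal (\<lambda>x. to_sphere k x i)" if "i \<in> {1..k}" for i
    unfolding to_sphere_def using that coord
    by (simp only: restrict_apply if_True)
      (intro continuous_map_real_divide continuous_map_sqrt continuous_map_sum
        continuous_map_real_pow; simp)
  then show ?thesis
    using to_sphere_in_pos_sphere[OF assms]
    by (auto simp: continuous_map_in_subtopology continuous_map_componentwise
        topspace_pos_orthant to_sphere_def)
qed

lemma continuous_map_from_sphere:
  assumes "k \<ge> 1"
  shows "continuous_map (subtopology (powertop_real {1..k}) (pos_sphere k))
           (subtopology (powertop_real {1..k-1}) (pos_orthant (k-1))) (from_sphere k)"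
proof -
  let ?Y = "subtopology (powertop_real {1..k}) (pos_sphere k)"
  have coord: "continuous_map ?Y euclideanreal (\<lambda>y. y j)" if "j \<in> {1..k}" for j
    using that by (intro continuous_map_from_subtopology continuous_map_product_coordinates)
  have "y k \<noteq> 0" if y: "y \<in> pos_sphere k" for y
  proof -
    have "y \<in> (\<Pi>\<^sub>E i\<in>{1..k}. {0<..})"
      using y by (simp add: pos_sphere_def pos_orthant_def)
    then have "y k \<in> {0<..}"
      by (rule PiE_mem) (use assms in simp)
    then show ?thesis by simp
  qed
  then have "continuous_map ?Y euclideanreal (\<lambda>y. from_sphere k y i)" if "i \<in> {1..k-1}" for i
    unfolding from_sphere_def using that coord[of i] coord[of k] assms
    by (simp only: restrict_apply if_True)
      (intro continuous_map_real_divide; force simp: topspace_pos_sphere)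
  then show ?thesis
    using from_sphere_in_pos_orthant[OF assms]
    by (auto simp: continuous_map_in_subtopology continuous_map_componentwise
        topspace_pos_sphere from_sphere_def)
qed

text \<open>
  Dividing the integer vector \<open>(a\<^sub>1, \<dots>, a\<^sub>k)\<close> by its last entry does not change its direction.
\<close>

lemma to_sphere_image_gen_ratio_set:
  assumes "k \<ge> 1" and B: "B \<subseteq> {1..}"
  shows "to_sphere k ` gen_ratio_set k A B = directions_set k A B"
proof -
  have dir: "to_sphere k (\<lambda>i\<in>{1..k-1}. real (a i) / real (a k)) =
      (\<lambda>i\<in>{1..k}. real (a i) / sqrt (\<Sum>j=1..k. (real (a j))\<^sup>2))"
    if "a k \<in> B" for a :: "nat \<Rightarrow> nat"
  proof
    fix i
    let ?x = "\<lambda>i\<in>{1..k-1}. real (a i) / real (a k)"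
    let ?v = "\<lambda>j. if j = k then 1 else ?x j"
    have ak: "real (a k) > 0"
      using that B by force
    have scaled: "real (a j) = real (a k) * ?v j" if "j \<in> {1..k}" for j
      using that ak by auto
    show "to_sphere k ?x i =
        (\<lambda>i\<in>{1..k}. real (a i) / sqrt (\<Sum>j=1..k. (real (a j))\<^sup>2)) i"
    proof (cases "i \<in> {1..k}")
      case True
      show ?thesis
        unfolding to_sphere_def restrict_apply'[OF True]
        using normalized_eq_of_proportional[of "real (a k)" k "\<lambda>j. real (a j)" ?v i, OF ak scaled True]
        by (rule sym)
    next
      case False
      then show ?thesis
        by (simp only: to_sphere_def restrict_def if_False)
    qed
  qed
  show ?thesis
  proof (intro set_eqI iffI)
    fix y assume "y \<in> to_sphere k ` gen_ratio_set k A B"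
    then obtain a b where ab: "\<forall>i\<in>{1..k-1}. a i \<in> A" "b \<in> B"
        "y = to_sphere k (\<lambda>i\<in>{1..k-1}. real (a i) / real b)"
      by (auto simp: gen_ratio_set_def)
    define a' where "a' = a(k := b)"
    have same: "a' i = a i" if "i \<in> {1..k-1}" for i
      using that by (auto simp: a'_def)
    have "(\<lambda>i\<in>{1..k-1}. real (a i) / real b) = (\<lambda>i\<in>{1..k-1}. real (a' i) / real (a' k))"
      using same by (auto simp: a'_def)
    then have "y = (\<lambda>i\<in>{1..k}. real (a' i) / sqrt (\<Sum>j=1..k. (real (a' j))\<^sup>2))"
      using ab dir[of a'] by (simp add: a'_def)
    moreover have "\<forall>i\<in>{1..k-1}. a' i \<in> A" "a' k \<in> B"
      using ab same by (auto simp: a'_def)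
    ultimately show "y \<in> directions_set k A B"
      unfolding directions_set_def by blast
  next
    fix y assume "y \<in> directions_set k A B"
    then obtain a where a: "\<forall>i\<in>{1..k-1}. a i \<in> A" "a k \<in> B"
        "y = (\<lambda>i\<in>{1..k}. real (a i) / sqrt (\<Sum>j=1..k. (real (a j))\<^sup>2))"
      unfolding directions_set_def by blast
    then have "y = to_sphere k (\<lambda>i\<in>{1..k-1}. real (a i) / real (a k))"
      using dir[of a] by simp
    moreover have "(\<lambda>i\<in>{1..k-1}. real (a i) / real (a k)) \<in> gen_ratio_set k A B"
      unfolding gen_ratio_set_def using a by blast
    ultimately show "y \<in> to_sphere k ` gen_ratio_set k A B"
      by blast
  qed
qed

lemma gen_ratio_set_subset_pos_orthant:
  assumes "A \<subseteq> {1..}" and "B \<subseteq> {1..}"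
  shows "gen_ratio_set k A B \<subseteq> pos_orthant (k-1)"
proof
  fix x assume "x \<in> gen_ratio_set k A B"
  then obtain a b where ab: "\<forall>i\<in>{1..k-1}. a i \<in> A" "b \<in> B"
      "x = (\<lambda>i\<in>{1..k-1}. real (a i) / real b)"
    by (auto simp: gen_ratio_set_def)
  have "0 < real (a i) / real b" if "i \<in> {1..k-1}" for i
    using ab assms that by (force intro: divide_pos_pos)
  then show "x \<in> pos_orthant (k-1)"
    unfolding ab(3) pos_orthant_def by auto
qed

lemma directions_dense_iff_gen_ratio_dense:
  assumes "k \<ge> 1" and AB: "A \<subseteq> {1..}" "B \<subseteq> {1..}"
  shows "directions_dense k A B \<longleftrightarrow> gen_ratio_dense k A B"
proof
  have "to_sphere k ` pos_orthant (k-1) = pos_sphere k"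
    using to_sphere_in_pos_sphere from_sphere_in_pos_orthant to_sphere_from_sphere assms(1)
    by (metis image_eqI image_subsetI subsetI subset_antisym)
  then show "directions_dense k A B" if "gen_ratio_dense k A B"
    using that dense_in_continuous_image[OF continuous_map_to_sphere[OF assms(1)]]
    unfolding gen_ratio_dense_def directions_dense_def
      to_sphere_image_gen_ratio_set[OF assms(1) AB(2), symmetric]
    by blast
  have "from_sphere k ` pos_sphere k = pos_orthant (k-1)"
    using to_sphere_in_pos_sphere from_sphere_in_pos_orthant from_sphere_to_sphere assms(1)
    by (metis image_eqI image_subsetI subsetI subset_antisym)
  moreover have "from_sphere k ` directions_set k A B = gen_ratio_set k A B"
    unfolding to_sphere_image_gen_ratio_set[OF assms(1) AB(2), symmetric] image_image
    using gen_ratio_set_subset_pos_orthant[OF AB, of k] from_sphere_to_sphere[OF assms(1)]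
    by (force simp: image_def)
  ultimately show "gen_ratio_dense k A B" if "directions_dense k A B"
    using that dense_in_continuous_image[OF continuous_map_from_sphere[OF assms(1)]]
    unfolding gen_ratio_dense_def directions_dense_def
    by metis
qed

section \<open>Gaps of an enumeration\<close>

lemma strict_mono_on_ge_index:
  fixes a :: "nat \<Rightarrow> nat"
  assumes "strict_mono_on {1..} a" and "a 1 \<ge> 1" and "n \<ge> 1"
  shows "n \<le> a n"
  using assms(3)
proof (induction n rule: dec_induct)
  case (step n)
  then have "a n < a (Suc n)"
    by (intro strict_mono_onD[OF assms(1)]) auto
  with step show ?case by simp
qed (use assms in simp)

lemma enumeration_at_top:
  fixes a :: "nat \<Rightarrow> nat"
  assumes "strict_mono_on {1..} a" and "a 1 \<ge> 1"
  shows "filterlim (\<lambda>n. real (a n)) at_top sequentially"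
proof (rule filterlim_at_top_mono[OF filterlim_real_sequentially])
  show "\<forall>\<^sub>F n in sequentially. real n \<le> real (a n)"
    using eventually_ge_at_top[of 1]
    by eventually_elim (use strict_mono_on_ge_index[OF assms] in simp)
qed

lemma relative_gaps_vanish_iff_consecutive_ratio:
  assumes A: "A \<subseteq> {1..}" and mono: "strict_mono_on {1..} a" and im: "A = a ` {1..}"
  shows "relative_gaps_vanish A \<longleftrightarrow> (\<lambda>n. real (a (n + 1)) / real (a n)) \<longlonglongrightarrow> 1"
proof
  have a1: "a 1 \<ge> 1"
    using A im by auto
  note top = enumeration_at_top[OF mono a1]
  have apos: "a n \<ge> 1" if "n \<ge> 1" for n
    using A im that by auto
  {
    assume gaps: "relative_gaps_vanish A"
    show "(\<lambda>n. real (a (n + 1)) / real (a n)) \<longlonglongrightarrow> 1"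
    proof (rule tendstoI)
      fix e :: real assume "e > 0"
      then have "\<forall>\<^sub>F t in at_top. \<exists>m\<in>A. t < real m \<and> real m \<le> (1 + e / 2) * t"
        using gaps unfolding relative_gaps_vanish_def by simp
      then have "\<forall>\<^sub>F n in sequentially.
          \<exists>m\<in>A. real (a n) < real m \<and> real m \<le> (1 + e / 2) * real (a n)"
        using top by (rule eventually_compose_filterlim)
      then show "\<forall>\<^sub>F n in sequentially. dist (real (a (n + 1)) / real (a n)) 1 < e"
        using eventually_ge_at_top[of 1]
      proof eventually_elim
        case (elim n)
        then obtain j where j: "j \<ge> 1" "a n < a j" "real (a j) \<le> (1 + e / 2) * real (a n)"
          using im by auto
        have "n < j"
          using j elim strict_mono_on_less[OF mono, of n j] by simp
        then have "a (n + 1) \<le> a j"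
          using elim strict_mono_on_leD[OF mono, of "n + 1" j] by simp
        then have "real (a (n + 1)) \<le> (1 + e / 2) * real (a n)"
          using j(3) by linarith
        moreover have "a n < a (n + 1)"
          using elim by (intro strict_mono_onD[OF mono]) auto
        moreover have "real (a n) > 0"
          using apos[of n] elim by simp
        ultimately have "1 \<le> real (a (n + 1)) / real (a n)"
            "real (a (n + 1)) / real (a n) \<le> 1 + e / 2"
          by (simp_all add: pos_divide_le_eq)
        then show ?case
          using \<open>e > 0\<close> by (simp add: dist_real_def)
      qed
    qed
  }
  {
    assume lim: "(\<lambda>n. real (a (n + 1)) / real (a n)) \<longlonglongrightarrow> 1"
    show "relative_gaps_vanish A"
      unfolding relative_gaps_vanish_def
    proof (intro allI impI)
      fix c :: real assume "c > 1"
      then have "\<forall>\<^sub>F n in sequentially. real (a (n + 1)) / real (a n) < c"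
        by (rule order_tendstoD(2)[OF lim])
      then obtain N0 where N0: "\<And>n. n \<ge> N0 \<Longrightarrow> real (a (n + 1)) / real (a n) < c"
        by (auto simp: eventually_sequentially)
      define N where "N = max 1 N0"
      show "\<forall>\<^sub>F t in at_top. \<exists>n\<in>A. t < real n \<and> real n \<le> c * t"
        using eventually_ge_at_top[of "real (a N)"]
      proof eventually_elim
        case (elim t)
        \<comment> \<open>The first element of \<open>A\<close> beyond \<open>t\<close> is at most \<open>c\<close> times its predecessor, which is
          at most \<open>t\<close>.\<close>
        let ?Q = "\<lambda>n. n \<ge> N \<and> t < real (a n)"
        define m where "m = (LEAST n. ?Q n)"
        have "\<forall>\<^sub>F n in sequentially. t < real (a n)"
          using top by (simp add: filterlim_at_top_dense)
        then have "\<exists>n. ?Q n"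
          by (metis eventually_sequentially le_cases)
        then have m: "m \<ge> N" "t < real (a m)"
          unfolding m_def by (metis (mono_tags, lifting) LeastI)+
        have "m \<noteq> N"
          using m(2) elim by auto
        then obtain p where p: "m = p + 1" "p \<ge> N"
          using m(1) by (cases m) auto
        have "\<not> ?Q p"
          using not_less_Least[of p ?Q] p(1) by (simp add: m_def)
        then have "real (a p) \<le> t"
          using p(2) by simp
        moreover have "real (a p) > 0"
          using apos[of p] p(2) by (simp add: N_def)
        moreover have "real (a m) / real (a p) < c"
          using N0[of p] p by (simp add: N_def)
        ultimately have "real (a m) \<le> c * real (a p)"
          by (simp add: pos_divide_less_eq)
        also have "\<dots> \<le> c * t"
          using \<open>real (a p) \<le> t\<close> \<open>c > 1\<close> by (intro mult_left_mono) auto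
        finally have "real (a m) \<le> c * t" .
        moreover have "a m \<in> A"
          using im p by auto
        ultimately show ?case using m(2) by blast
      qed
    qed
  }
qed

text \<open>
  Both directions compare the maximum with single gaps: it is at least the last gap
  \<open>a\<^sub>n - a\<^sub>n\<^sub>-\<^sub>1\<close>, and at most the larger of a fixed initial maximum and a small multiple of \<open>a\<^sub>n\<close>.
\<close>

lemma consecutive_ratio_iff_max_gap:
  assumes A: "A \<subseteq> {1..}" and mono: "strict_mono_on {1..} a" and im: "A = a ` {1..}"
  shows "(\<lambda>n. real (a (n + 1)) / real (a n)) \<longlonglongrightarrow> 1 \<longleftrightarrow>
    (\<lambda>n. 1 / real (a n) *
      Max (insert (real (a 1)) ((\<lambda>i. real (a (i + 1)) - real (a i)) ` {1..n-1}))) \<longlonglongrightarrow> 0"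
proof
  have a1: "a 1 \<ge> 1"
    using A im by auto
  note top = enumeration_at_top[OF mono a1]
  have apos: "real (a n) > 0" if "n \<ge> 1" for n
    using A im that by force
  define d where "d = (\<lambda>i. real (a (i + 1)) - real (a i))"
  define M where "M n = Max (insert (real (a 1)) (d ` {1..n-1}))" for n
  have M_ge: "d i \<le> M n" if "i \<in> {1..n-1}" for i n
    unfolding M_def using that by (intro Max_ge) auto
  have M_ge1: "real (a 1) \<le> M n" for n
    unfolding M_def by (intro Max_ge) auto
  {
    assume lim: "(\<lambda>n. real (a (n + 1)) / real (a n)) \<longlonglongrightarrow> 1"
    have "(\<lambda>n. 1 / real (a n) * M n) \<longlonglongrightarrow> 0"
    proof (rule tendstoI)
      fix e :: real assume "e > 0"
      then have "\<forall>\<^sub>F n in sequentially. real (a (n + 1)) / real (a n) < 1 + e / 2"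
        by (intro order_tendstoD(2)[OF lim]) simp
      then obtain N0 where N0: "\<And>n. n \<ge> N0 \<Longrightarrow> real (a (n + 1)) / real (a n) < 1 + e / 2"
        by (auto simp: eventually_sequentially)
      define N where "N = max 1 N0"
      have small: "d i \<le> e / 2 * real (a i)" if "i \<ge> N" for i
        using N0[of i] apos[of i] that
        by (simp add: N_def d_def pos_divide_less_eq algebra_simps)
      have M_le: "M n \<le> max (M N) (e / 2 * real (a n))" for n
        unfolding M_def[of n]
      proof (subst Max_le_iff; safe?)
        show "real (a 1) \<le> max (M N) (e / 2 * real (a n))"
          using M_ge1[of N] by simp
        fix i assume i: "i \<in> {1..n-1}"
        show "d i \<le> max (M N) (e / 2 * real (a n))"
        proof (cases "i < N")
          case True
          then show ?thesis
            using M_ge[of i N] i by (simp add: le_max_iff_disj)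
        next
          case False
          have "a i \<le> a n"
            using i by (intro strict_mono_on_leD[OF mono]) auto
          then have "e / 2 * real (a i) \<le> e / 2 * real (a n)"
            using \<open>e > 0\<close> by simp
          then show ?thesis
            using small[of i] False by simp
        qed
      qed auto
      have "\<forall>\<^sub>F n in sequentially. M N / e < real (a n)"
        using top by (simp add: filterlim_at_top_dense)
      then show "\<forall>\<^sub>F n in sequentially. dist (1 / real (a n) * M n) 0 < e"
        using eventually_ge_at_top[of 1]
      proof eventually_elim
        case (elim n)
        have an: "real (a n) > 0"
          using apos elim by simp
        have "M N < e * real (a n)"
          using elim(1) \<open>e > 0\<close> by (simp add: field_simps)
        moreover have "e / 2 * real (a n) < e * real (a n)"
          using \<open>e > 0\<close> an by simp
        ultimately have "M n < e * real (a n)"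
          using M_le[of n] by linarith
        moreover have "M n \<ge> 0"
          using M_ge1[of n] by linarith
        ultimately show ?case
          using an by (simp add: dist_real_def pos_divide_less_eq)
      qed
    qed
    then show "(\<lambda>n. 1 / real (a n) *
        Max (insert (real (a 1)) ((\<lambda>i. real (a (i + 1)) - real (a i)) ` {1..n-1}))) \<longlonglongrightarrow> 0"
      by (simp only: M_def d_def)
  }
  {
    assume "(\<lambda>n. 1 / real (a n) *
        Max (insert (real (a 1)) ((\<lambda>i. real (a (i + 1)) - real (a i)) ` {1..n-1}))) \<longlonglongrightarrow> 0"
    then have "(\<lambda>n. 1 / real (a n) * M n) \<longlonglongrightarrow> 0"
      by (simp only: M_def d_def)
    then have lim: "(\<lambda>n. 1 / real (a (n + 1)) * M (n + 1)) \<longlonglongrightarrow> 0"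
      by (rule LIMSEQ_ignore_initial_segment)
    have "(\<lambda>n. d n / real (a (n + 1))) \<longlonglongrightarrow> 0"
    proof (rule tendsto_sandwich[OF _ _ tendsto_const lim])
      show "\<forall>\<^sub>F n in sequentially. 0 \<le> d n / real (a (n + 1))"
        using eventually_ge_at_top[of 1]
      proof eventually_elim
        case (elim n)
        then have "a n < a (n + 1)"
          by (intro strict_mono_onD[OF mono]) auto
        then show ?case by (simp add: d_def)
      qed
      show "\<forall>\<^sub>F n in sequentially. d n / real (a (n + 1)) \<le> 1 / real (a (n + 1)) * M (n + 1)"
        using eventually_ge_at_top[of 1]
      proof eventually_elim
        case (elim n)
        then have "d n \<le> M (n + 1)"
          by (intro M_ge) auto
        then show ?case by (simp add: divide_right_mono)
      qed
    qed
    then have "(\<lambda>n. inverse (1 - d n / real (a (n + 1)))) \<longlonglongrightarrow> inverse (1 - 0)"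
      by (intro tendsto_intros) auto
    then have "(\<lambda>n. inverse (1 - d n / real (a (n + 1)))) \<longlonglongrightarrow> 1"
      by simp
    then show "(\<lambda>n. real (a (n + 1)) / real (a n)) \<longlonglongrightarrow> 1"
    proof (rule Lim_transform_eventually)
      show "\<forall>\<^sub>F n in sequentially.
          inverse (1 - d n / real (a (n + 1))) = real (a (n + 1)) / real (a n)"
      proof (rule always_eventually, rule allI)
        fix n
        have "real (a (n + 1)) > 0"
          by (rule apos) simp
        then have "1 - d n / real (a (n + 1)) = real (a n) / real (a (n + 1))"
          by (simp add: d_def field_simps)
        then show "inverse (1 - d n / real (a (n + 1))) = real (a (n + 1)) / real (a n)"
          by simp
      qed
    qed
  }
qed

section \<open>The equivalence\<close>

theorem theorem3:
  fixes A :: "nat set" and a :: "nat \<Rightarrow> nat"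
  assumes "A \<subseteq> {1..}" and "infinite A"
    and "strict_mono_on {1..} a" and "A = a ` {1..}"
  shows "all_equivalent
    [\<forall>c::real. c > 1 \<longrightarrow> (\<forall>\<^sub>F t in at_top. counting A (c * t) > counting A t),
     \<forall>c::real. c > 1 \<longrightarrow>
       filterlim (\<lambda>t. real (counting A (c * t)) - real (counting A t)) at_top at_top,
     \<forall>k\<ge>2. \<forall>B. B \<subseteq> {1..} \<and> infinite B \<longrightarrow> gen_ratio_dense k A B,
     \<forall>k\<ge>2. \<forall>B. B \<subseteq> {1..} \<and> infinite B \<longrightarrow> directions_dense k A B,
     \<exists>k\<ge>2. \<forall>B. B \<subseteq> {1..} \<and> infinite B \<longrightarrow> gen_ratio_dense k A B,
     \<exists>k\<ge>2. \<forall>B. B \<subseteq> {1..} \<and> infinite B \<longrightarrow> directions_dense k A B,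
     \<forall>B. B \<subseteq> {1..} \<and> infinite B \<longrightarrow> (\<exists>k\<ge>2. gen_ratio_dense k A B),
     \<forall>B. B \<subseteq> {1..} \<and> infinite B \<longrightarrow> (\<exists>k\<ge>2. directions_dense k A B),
     N_dense A,
     (\<lambda>n. real (a (n + 1)) / real (a n)) \<longlonglongrightarrow> 1,
     (\<lambda>n. 1 / real (a n) *
        Max (insert (real (a 1)) ((\<lambda>i. real (a (i + 1)) - real (a i)) ` {1..n-1}))) \<longlonglongrightarrow> 0]"
proof -
  let ?G = "relative_gaps_vanish A"
  have dir: "directions_dense k A B \<longleftrightarrow> gen_ratio_dense k A B" if "k \<ge> 2" "B \<subseteq> {1..}" for k B
    using directions_dense_iff_gen_ratio_dense[OF _ assms(1)] that by simp
  have strong: "gen_ratio_dense k A B" if ?G "infinite B" for k B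
    using relative_gaps_vanish_imp_gen_ratio_dense that by blast
  have weak: ?G if each: "\<forall>B. B \<subseteq> {1..} \<and> infinite B \<longrightarrow> (\<exists>k\<ge>2. gen_ratio_dense k A B)"
  proof (intro N_dense_imp_relative_gaps_vanish, unfold N_dense_def, intro allI impI)
    fix B :: "nat set" assume "B \<subseteq> {1..} \<and> infinite B"
    then obtain k where "k \<ge> 2" "gen_ratio_dense k A B"
      using each by blast
    then show "dense_in euclideanreal {0<..} (ratio_set A B)"
      by (rule gen_ratio_dense_imp_ratio_set_dense)
  qed
  have i: "(\<forall>c::real. c > 1 \<longrightarrow> (\<forall>\<^sub>F t in at_top. counting A (c * t) > counting A t)) \<longleftrightarrow> ?G"
    by (rule relative_gaps_vanish_iff_counting_less[symmetric])
  have ii: "(\<forall>c::real. c > 1 \<longrightarrow>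
      filterlim (\<lambda>t. real (counting A (c * t)) - real (counting A t)) at_top at_top) \<longleftrightarrow> ?G"
    by (rule relative_gaps_vanish_iff_counting_diff_at_top[symmetric])
  have iii: "(\<forall>k\<ge>2. \<forall>B. B \<subseteq> {1..} \<and> infinite B \<longrightarrow> gen_ratio_dense k A B) \<longleftrightarrow> ?G"
    by (rule iffI) (blast intro: weak, blast intro: strong)
  have iv: "(\<forall>k\<ge>2. \<forall>B. B \<subseteq> {1..} \<and> infinite B \<longrightarrow> directions_dense k A B) \<longleftrightarrow> ?G"
    unfolding iii[symmetric] using dir by metis
  have v: "(\<exists>k\<ge>2. \<forall>B. B \<subseteq> {1..} \<and> infinite B \<longrightarrow> gen_ratio_dense k A B) \<longleftrightarrow> ?G"
    by (rule iffI) (blast intro: weak, blast intro: strong)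
  have vi: "(\<exists>k\<ge>2. \<forall>B. B \<subseteq> {1..} \<and> infinite B \<longrightarrow> directions_dense k A B) \<longleftrightarrow> ?G"
    unfolding v[symmetric] using dir by metis
  have vii: "(\<forall>B. B \<subseteq> {1..} \<and> infinite B \<longrightarrow> (\<exists>k\<ge>2. gen_ratio_dense k A B)) \<longleftrightarrow> ?G"
    by (rule iffI) (blast intro: weak, blast intro: strong)
  have viii: "(\<forall>B. B \<subseteq> {1..} \<and> infinite B \<longrightarrow> (\<exists>k\<ge>2. directions_dense k A B)) \<longleftrightarrow> ?G"
    unfolding vii[symmetric] using dir by metis
  have ix: "N_dense A \<longleftrightarrow> ?G"
  proof
    assume ?G
    then show "N_dense A"
      unfolding N_dense_def
      using gen_ratio_dense_imp_ratio_set_dense[OF order_refl] strong by metis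
  qed (rule N_dense_imp_relative_gaps_vanish)
  note x = relative_gaps_vanish_iff_consecutive_ratio[OF assms(1,3,4), symmetric]
  note xi = consecutive_ratio_iff_max_gap[OF assms(1,3,4), symmetric]
  show ?thesis
    unfolding all_equivalent_def i ii iii iv v vi vii viii ix xi x by simp
qed

end
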